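(* Let $A\in M_n(\mathbb C)$ be normal, with spectral decomposition $A=\sum_{\alpha=1}^d\mu_\alpha P_\alpha$, where $\mu_1,\dots,\mu_d$ are the distinct eigenvalues of $A$, $P_\alpha$ is the orthogonal projection onto the eigenspace $E_\alpha=\ker(A-\mu_\alpha I)$, and $m_\alpha=\dim E_\alpha$. For a unit vector $u\in\mathbb C^n$ put $u_\alpha=P_\alpha u$ and $p_\alpha=\|u_\alpha\|^2$, so that $\sum_{\alpha=1}^d p_\alpha=1$. Then \[ z(u)=u^*Au=\sum_{\alpha=1}^d p_\alpha\mu_\alpha,\qquad \rho(u)=\sum_{\alpha=1}^d p_\alpha|\mu_\alpha-z(u)|^2 . \] Let $S=\{\alpha: p_\alpha>0\}$. Then $[u]\in\mathbb{CP}^{n-1}$ is a critical point of $\rho$ if and only if \[ |\mu_\alpha-z(u)|^2=\rho(u)\qquad\text{for every }\alpha\in S. \] Equivalently, the eigenvalues $\{\mu_\alpha:\alpha\in S\}$ lie on the circle centered at $z(u)$ with radius $\sqrt{\rho(u)}$. Finally, for a fixed pair $(S,p)$ arising in this way from a critical point, the corresponding critical set in the unit sphere (the set of unit vectors $u$ with $[u]$ critical whose active set is $S$ and whose weights are $p$) is \[ \widetilde C(S,p)=\left\{u\in \mathbb S^{2n-1}: \|P_\alpha u\|^2=p_\alpha\ (\alpha\in S),\quad P_\beta u=0\ (\beta\notin S)\right\}. \]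
   Context: For a unit vector $u\in\mathbb C^n$, $\rho(u)=\rho_A(u)=\|Au-(u^*Au)u\|^2$ is the squared Rayleigh residual. It is invariant under $u\mapsto e^{i\theta}u$ and hence descends to a smooth function on $\mathbb{CP}^{n-1}$; critical points are critical points of this function on $\mathbb{CP}^{n-1}$. $\mathbb S^{2n-1}$ is the unit sphere of $\mathbb C^n$. A circle of radius $0$ is understood as its center. *)

theory Defs
  imports "HOL-Analysis.Analysis"
begin

definition cdot :: "complex^'n \<Rightarrow> complex^'n \<Rightarrow> complex" where
  "cdot u v = (\<Sum>i\<in>UNIV. cnj (u $ i) * v $ i)"

definition conj_transpose :: "complex^'n^'m \<Rightarrow> complex^'m^'n" where
  "conj_transpose A = (\<chi> i j. cnj (A $ j $ i))"

definition normal_matrix :: "complex^'n^'n \<Rightarrow> bool" where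
  "normal_matrix A \<longleftrightarrow> A ** conj_transpose A = conj_transpose A ** A"

definition eigenspace :: "complex^'n^'n \<Rightarrow> complex \<Rightarrow> (complex^'n) set" where
  "eigenspace A c = {x. (A - mat c) *v x = 0}"

definition eigenvalues :: "complex^'n^'n \<Rightarrow> complex set" where
  "eigenvalues A = {c. \<exists>x. x \<noteq> 0 \<and> A *v x = c *s x}"

definition orth_projection_onto :: "complex^'n^'n \<Rightarrow> (complex^'n) set \<Rightarrow> bool" where
  "orth_projection_onto Q E \<longleftrightarrow>
     (\<forall>x. Q *v x \<in> E \<and> (\<forall>y\<in>E. cdot y (x - Q *v x) = 0))"

definition rayleigh :: "complex^'n^'n \<Rightarrow> complex^'n \<Rightarrow> complex" where
  "rayleigh A u = cdot u (A *v u)"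

definition residual :: "complex^'n^'n \<Rightarrow> complex^'n \<Rightarrow> real" where
  "residual A u = (norm (A *v u - rayleigh A u *s u))\<^sup>2"

definition weight :: "(nat \<Rightarrow> complex^'n^'n) \<Rightarrow> complex^'n \<Rightarrow> nat \<Rightarrow> real" where
  "weight P u \<alpha> = (norm (P \<alpha> *v u))\<^sup>2"

definition active_set :: "nat \<Rightarrow> (nat \<Rightarrow> complex^'n^'n) \<Rightarrow> complex^'n \<Rightarrow> nat set" where
  "active_set d P u = {\<alpha>\<in>{1..d}. weight P u \<alpha> > 0}"

text \<open>
  Complex projective space is the quotient of the unit sphere of \<open>complex^'n\<close> by the
  scalars of modulus one. The equivalence relation is partial (its domain is the unit sphere), so
  \<open>abs_cproj u\<close> denotes the point \<open>[u]\<close> only for unit vectors \<open>u\<close>.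
\<close>

definition phase_equiv :: "complex^'n \<Rightarrow> complex^'n \<Rightarrow> bool" where
  "phase_equiv u v \<longleftrightarrow> norm u = 1 \<and> norm v = 1 \<and> (\<exists>c. cmod c = 1 \<and> v = c *s u)"

lemma norm_vector_scalar_mult: "norm (c *s x) = cmod c * norm (x :: complex^'n)"
  by (simp add: norm_vec_def L2_set_def norm_mult power_mult_distrib real_sqrt_mult
      flip: sum_distrib_left)

lemma phase_equiv_refl: "norm u = 1 \<Longrightarrow> phase_equiv u u"
  unfolding phase_equiv_def by (metis norm_one vector_smult_lid)

lemma part_equivp_phase_equiv: "part_equivp (phase_equiv :: complex^'n \<Rightarrow> _)"
proof (rule part_equivpI)
  show "\<exists>x :: complex^'n. phase_equiv x x"
    using phase_equiv_refl vector_choose_size[of 1] by (metis zero_le_one)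
  show "symp (phase_equiv :: complex^'n \<Rightarrow> _)"
  proof (rule sympI)
    fix u v :: "complex^'n" assume "phase_equiv u v"
    then obtain c where c: "norm u = 1" "norm v = 1" "cmod c = 1" "v = c *s u"
      unfolding phase_equiv_def by blast
    moreover from c have "c \<noteq> 0" by auto
    ultimately have "u = inverse c *s v" "cmod (inverse c) = 1"
      by (auto simp: vector_smult_assoc norm_inverse)
    with c show "phase_equiv v u" unfolding phase_equiv_def by blast
  qed
  show "transp (phase_equiv :: complex^'n \<Rightarrow> _)"
  proof (rule transpI)
    fix u v w :: "complex^'n" assume "phase_equiv u v" "phase_equiv v w"
    then obtain c e where "norm u = 1" "norm w = 1" "cmod c = 1" "cmod e = 1"
        "w = (e * c) *s u"
      unfolding phase_equiv_def by (auto simp: vector_smult_assoc)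
    then show "phase_equiv u w" unfolding phase_equiv_def
      by (intro conjI exI[of _ "e * c"]) (simp_all add: norm_mult)
  qed
qed

quotient_type 'n cproj = "complex^'n::finite" / partial: phase_equiv
  by (rule part_equivp_phase_equiv)

lemma rayleigh_phase:
  assumes "cmod c = 1" shows "rayleigh A (c *s u) = rayleigh A u"
proof -
  have c: "cnj c * c = 1"
    using assms by (simp add: complex_norm_square[symmetric] mult.commute)
  have "rayleigh A (c *s u) = (\<Sum>i\<in>UNIV. (cnj c * c) * (cnj (u $ i) * (A *v u) $ i))"
    unfolding rayleigh_def cdot_def
    by (simp add: vector_scalar_commute algebra_simps)
  then show ?thesis by (simp add: c rayleigh_def cdot_def)
qed

lift_definition cproj_residual :: "complex^'n^'n \<Rightarrow> 'n::finite cproj \<Rightarrow> real" is residual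
proof -
  fix A :: "complex^'n^'n" and u v :: "complex^'n"
  assume "phase_equiv u v"
  then obtain c where c: "cmod c = 1" "v = c *s u" unfolding phase_equiv_def by blast
  have "A *v (c *s u) - rayleigh A u *s (c *s u) = c *s (A *v u - rayleigh A u *s u)"
    by (simp add: vector_scalar_commute vec_eq_iff right_diff_distrib mult.left_commute)
  then have "norm (A *v (c *s u) - rayleigh A u *s (c *s u)) = norm (A *v u - rayleigh A u *s u)"
    by (simp only: norm_vector_scalar_mult c mult_1)
  then show "residual A u = residual A v"
    by (simp only: residual_def c rayleigh_phase)
qed

text \<open>
  The smooth structure is given by the standard affine charts: on \<open>{[u]. u $ k \<noteq> 0}\<close>
  the \<open>k\<close>-th chart is \<open>[u] \<mapsto> u / u $ k\<close>. Its image, the affine hyperplane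
  \<open>{w. w $ k = 1}\<close>, plays the role of the coordinate space of complex dimension one less than
  that of \<open>complex^'n\<close>.
\<close>

lift_definition cproj_chart_dom :: "'n \<Rightarrow> 'n::finite cproj \<Rightarrow> bool" is "\<lambda>k u. u $ k \<noteq> 0"
  by (auto simp: phase_equiv_def)

lift_definition cproj_chart :: "'n \<Rightarrow> 'n::finite cproj \<Rightarrow> complex^'n" is
  "\<lambda>k u. (1 / u $ k) *s u"
  by (auto simp: phase_equiv_def vec_eq_iff)

definition cproj_chart_inv :: "'n::finite \<Rightarrow> complex^'n \<Rightarrow> 'n cproj" where
  "cproj_chart_inv k w = abs_cproj (sgn w)"

lemma cproj_chart_chart_inv:
  assumes "w $ k = 1"
  shows "cproj_chart_dom k (cproj_chart_inv k w)" "cproj_chart k (cproj_chart_inv k w) = w"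
proof -
  have "w \<noteq> 0" using assms by auto
  then have *: "phase_equiv (sgn w) (sgn w)" by (intro phase_equiv_refl) (simp add: norm_sgn)
  show "cproj_chart_dom k (cproj_chart_inv k w)"
    unfolding cproj_chart_inv_def using * assms \<open>w \<noteq> 0\<close>
    by (simp add: cproj_chart_dom.abs_eq sgn_vec_def)
  have "complex_of_real (norm w) \<noteq> 0" using \<open>w \<noteq> 0\<close> by simp
  then have "(1 / sgn w $ k) *s sgn w = w"
    using assms by (simp add: vec_eq_iff sgn_vec_def) (simp add: scaleR_conv_of_real field_simps)
  then show "cproj_chart k (cproj_chart_inv k w) = w"
    unfolding cproj_chart_inv_def using * by (simp add: cproj_chart.abs_eq)
qed

text \<open>
  A point is critical if the coordinate expression of the function in every affine chart around
  the point has vanishing derivative there. Differentiation within the hyperplane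
  \<open>{w. w $ k = 1}\<close> only tests real directions tangent to it, so the zero map expresses
  vanishing of the whole real differential on projective space.
\<close>

definition cproj_critical :: "('n::finite cproj \<Rightarrow> real) \<Rightarrow> 'n cproj \<Rightarrow> bool" where
  "cproj_critical f x \<longleftrightarrow>
     (\<forall>k. cproj_chart_dom k x \<longrightarrow>
        ((\<lambda>w. f (cproj_chart_inv k w)) has_derivative (\<lambda>h. 0))
          (at (cproj_chart k x) within {w. w $ k = 1}))"

end

theory Submission
  imports Defs "HOL-Computational_Algebra.Fundamental_Theorem_Algebra"
begin

text \<open>
  The spectral resolution rests on one fact about a normal matrix: only the zero vector is
  orthogonal to all of its eigenvectors (\<open>normal_eigenvectors_total\<close>). An eigenvector of a
  normal matrix is also an eigenvector of its adjoint, so the vectors orthogonal to all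
  eigenvectors form an invariant subspace. A nonzero invariant complex subspace contains an
  eigenvector, which here would be orthogonal to itself. For the same reason eigenspaces of
  different eigenvalues are orthogonal. Hence the \<open>P \<alpha> *v u\<close> are orthogonal components that
  add up to \<open>u\<close>, and the norm, the Rayleigh quotient and the residual become sums over the
  weights by Pythagoras.

  For criticality, \<open>w \<mapsto> residual A (sgn w)\<close> extends the residual from the unit sphere to all
  nonzero vectors and is invariant under all nonzero complex scalars, so it is simultaneously the
  coordinate expression in every affine chart. With
  \<open>p\<^sub>\<alpha> = \<parallel>P\<^sub>\<alpha> w\<parallel>\<^sup>2\<close> and \<open>N = \<Sum> p\<^sub>\<alpha>\<close>, the extension equals
  \<open>(\<Sum> p\<^sub>\<alpha> |\<mu>\<^sub>\<alpha>|\<^sup>2) / N - |\<Sum> p\<^sub>\<alpha> \<mu>\<^sub>\<alpha>|\<^sup>2 / N\<^sup>2\<close>,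
  a function of the weights, whose partial derivative in
  \<open>p\<^sub>\<alpha>\<close> at a unit vector is \<open>|\<mu>\<^sub>\<alpha> - z|\<^sup>2 - \<rho>\<close>. The real gradient at \<open>u\<close> is therefore
  twice
  \<open>\<Sum> (|\<mu>\<^sub>\<alpha> - z|\<^sup>2 - \<rho>) u\<^sub>\<alpha>\<close>, where \<open>u\<^sub>\<alpha>\<close> is the component of \<open>u\<close> in the
  eigenspace of \<open>\<mu>\<^sub>\<alpha>\<close> (\<open>has_derivative_residual\<close>).

  The gradient is complex-orthogonal to \<open>u\<close>, that is, to the directions that are lost in
  projective space. So the differential on projective space vanishes exactly if the gradient does
  (\<open>critical_iff_gradient_eq_0\<close>). Since the components are orthogonal, the
  gradient vanishes exactly if each coefficient belonging to a nonzero component does. This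
  condition involves \<open>u\<close> only through its weights, and this gives the description of the
  critical sets.
\<close>

section \<open>The Hermitian form\<close>

lemma cdot_add_right: "cdot x (y + z) = cdot x y + cdot x z"
  by (simp add: cdot_def sum.distrib algebra_simps)

lemma cdot_diff_right: "cdot x (y - z) = cdot x y - cdot x z"
  by (simp add: cdot_def sum_subtractf algebra_simps)

lemma cdot_scale_right: "cdot x (c *s y) = c * cdot x y"
  by (simp add: cdot_def sum_distrib_left algebra_simps)

lemma cdot_scale_left: "cdot (c *s x) y = cnj c * cdot x y"
  by (simp add: cdot_def sum_distrib_left algebra_simps)

lemma cdot_zero_right [simp]: "cdot x 0 = 0"
  by (simp add: cdot_def)

lemma cdot_sum_right: "cdot x (sum f S) = (\<Sum>a\<in>S. cdot x (f a))"
  by (induction S rule: infinite_finite_induct) (simp_all add: cdot_add_right)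

lemma cnj_cdot: "cnj (cdot x y) = cdot y x"
  by (simp add: cdot_def mult.commute)

lemma cdot_diff_left: "cdot (y - z) x = cdot y x - cdot z x"
  by (simp add: cdot_def sum_subtractf algebra_simps)

lemma cdot_sum_left: "cdot (sum f S) y = (\<Sum>a\<in>S. cdot (f a) y)"
  by (subst cnj_cdot[symmetric]) (simp add: cdot_sum_right cnj_cdot)

lemma cdot_self: "cdot x x = complex_of_real ((norm x)\<^sup>2)"
proof -
  have "(norm x)\<^sup>2 = (\<Sum>i\<in>UNIV. (cmod (x $ i))\<^sup>2)"
    by (simp add: norm_vec_def L2_set_def sum_nonneg)
  then show ?thesis
    unfolding cdot_def
    by (simp add: complex_norm_square mult.commute del: of_real_power)
qed

lemma inner_eq_Re_cdot: "x \<bullet> y = Re (cdot x y)"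
  by (simp add: inner_vec_def cdot_def inner_complex_def)

lemma cdot_adjoint: "cdot x (A *v y) = cdot (conj_transpose A *v x) y"
proof -
  have "cdot x (A *v y) = (\<Sum>i\<in>UNIV. \<Sum>j\<in>UNIV. cnj (x $ i) * A $ i $ j * y $ j)"
    by (simp add: cdot_def matrix_vector_mult_def sum_distrib_left mult.assoc)
  also have "\<dots> = (\<Sum>j\<in>UNIV. \<Sum>i\<in>UNIV. cnj (x $ i) * A $ i $ j * y $ j)"
    by (rule sum.swap)
  also have "\<dots> = cdot (conj_transpose A *v x) y"
    by (simp add: cdot_def matrix_vector_mult_def conj_transpose_def sum_distrib_left mult_ac)
  finally show ?thesis .
qed

lemma conj_transpose_involution: "conj_transpose (conj_transpose A) = A"
  by (simp add: conj_transpose_def vec_eq_iff)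

lemma mat_mult_vec: "mat c *v x = c *s (x :: complex^'n)"
  by (simp add: vec_eq_iff matrix_vector_mult_def mat_def if_distrib[of "\<lambda>a. a * _"] cong: if_cong)

lemma smult_of_real: "complex_of_real r *s x = r *\<^sub>R x"
  by (simp add: vec_eq_iff) (simp add: scaleR_conv_of_real)

lemma mem_eigenspace: "x \<in> eigenspace A c \<longleftrightarrow> A *v x = c *s x"
  by (simp add: eigenspace_def matrix_vector_mult_diff_rdistrib mat_mult_vec)

section \<open>Eigenvectors in invariant subspaces\<close>

text \<open>This is the vector \<open>p(A) x\<close>.\<close>

definition poly_orbit :: "complex poly \<Rightarrow> complex^'n^'n \<Rightarrow> complex^'n \<Rightarrow> complex^'n" where
  "poly_orbit p A x = (\<Sum>i\<le>degree p. coeff p i *s (((*v) A ^^ i) x))"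

text \<open>
  A common summation bound makes polynomials of different degrees comparable; the additional
  coefficients vanish.
\<close>

lemma poly_orbit_bound:
  assumes "degree p \<le> n"
  shows "poly_orbit p A x = (\<Sum>i\<le>n. coeff p i *s (((*v) A ^^ i) x))"
  unfolding poly_orbit_def using assms
  by (intro sum.mono_neutral_left) (auto simp: coeff_eq_0)

lemma matrix_power_diff:
  fixes A :: "complex^'n^'n"
  shows "((*v) A ^^ i) (x - y) = ((*v) A ^^ i) x - ((*v) A ^^ i) (y :: complex^'n)"
  by (induction i) (simp_all add: matrix_vector_mult_diff_distrib)

lemma matrix_power_scale:
  fixes A :: "complex^'n^'n"
  shows "((*v) A ^^ i) (c *s x) = c *s ((*v) A ^^ i) (x :: complex^'n)"
  by (induction i) (simp_all add: vector_scalar_commute)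

text \<open>
  Peeling the factor \<open>X - c\<close> off the polynomial moves it to the vector. This step drives the
  induction in \<open>eigenvector_in_invariant_subspace\<close>.
\<close>

lemma poly_orbit_linear_factor:
  "poly_orbit ([:- c, 1:] * q) A x = poly_orbit q A (A *v x - c *s x)"
proof -
  define n where "n = degree q"
  let ?T = "\<lambda>i. ((*v) A ^^ i) x"
  have deg: "degree ([:- c, 1:] * q) \<le> Suc n"
    using degree_mult_le[of "[:- c, 1:]" q] by (simp add: n_def)
  have coef: "coeff ([:- c, 1:] * q) i = (if i = 0 then 0 else coeff q (i - 1)) - c * coeff q i" for i
    by (cases i) simp_all
  have shift: "?T (Suc i) = ((*v) A ^^ i) (A *v x)" for i
    by (simp add: funpow_Suc_right del: funpow.simps)
  have q0: "coeff q (Suc n) = 0" by (simp add: n_def coeff_eq_0)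
  have "poly_orbit ([:- c, 1:] * q) A x =
      (\<Sum>i\<le>Suc n. (if i = 0 then 0 else coeff q (i - 1)) *s ?T i) - (\<Sum>i\<le>Suc n. (c * coeff q i) *s ?T i)"
    unfolding poly_orbit_bound[OF deg] coef by (simp only: vec.scale_left_diff_distrib sum_subtractf)
  also have "(\<Sum>i\<le>Suc n. (if i = 0 then 0 else coeff q (i - 1)) *s ?T i) = (\<Sum>i\<le>n. coeff q i *s ?T (Suc i))"
    by (subst sum.atMost_Suc_shift) simp
  also have "(\<Sum>i\<le>Suc n. (c * coeff q i) *s ?T i) = (\<Sum>i\<le>n. (c * coeff q i) *s ?T i)"
    using q0 by simp
  also have "(\<Sum>i\<le>n. coeff q i *s ?T (Suc i)) - (\<Sum>i\<le>n. (c * coeff q i) *s ?T i)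
     = poly_orbit q A (A *v x - c *s x)"
    unfolding poly_orbit_def n_def[symmetric] matrix_power_diff matrix_power_scale shift
    by (simp add: sum_subtractf vec.scale_right_diff_distrib mult.commute del: funpow.simps)
  finally show ?thesis .
qed

text \<open>
  The vectors \<open>x, A x, A\<^sup>2 x, \<dots>\<close> live in a finite-dimensional real space, so more of them than its
  dimension satisfy a linear relation, even one with real coefficients. Two equal
  powers give a relation as well; they are treated apart because a linear relation on a
  set does not see repetitions.
\<close>

lemma annihilating_poly_exists:
  fixes A :: "complex^'n^'n"
  shows "\<exists>p. p \<noteq> 0 \<and> poly_orbit p A x = 0"
proof -
  let ?T = "\<lambda>i. ((*v) A ^^ i) x"
  define m where "m = DIM(complex^'n)"
  show ?thesis
  proof (cases "inj_on ?T {..m}")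
    case False
    then obtain i j where ij: "i \<noteq> j" "?T i = ?T j" by (auto simp: inj_on_def)
    define p :: "complex poly" where "p = monom 1 i - monom 1 j"
    have "coeff p i = 1" using ij by (simp add: p_def)
    then have "p \<noteq> 0" by auto
    have "degree p \<le> max i j"
      unfolding p_def using degree_diff_le_max[of "monom 1 i :: complex poly" "monom 1 j"]
      by (simp add: degree_monom_eq)
    from poly_orbit_bound[OF this, where A = A and x = x]
    have "poly_orbit p A x = (\<Sum>k\<le>max i j. (if k = i then ?T k else 0) - (if k = j then ?T k else 0))"
      by (simp only:) (auto simp: p_def vec.scale_left_diff_distrib intro!: sum.cong)
    also have "\<dots> = 0" using ij by (simp add: sum_subtractf)
    finally show ?thesis using \<open>p \<noteq> 0\<close> by blast
  next
    case True
    have "dependent (?T ` {..m})"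
      using True by (intro dependent_biggerset) (simp add: card_image m_def)
    then obtain r v where r: "(\<Sum>w\<in>?T ` {..m}. r w *\<^sub>R w) = 0" "v \<in> ?T ` {..m}" "r v \<noteq> 0"
      by (auto simp: dependent_finite)
    then obtain k where k: "k \<le> m" "v = ?T k" by auto
    define p where "p = (\<Sum>i\<le>m. monom (complex_of_real (r (?T i))) i)"
    have coef: "coeff p i = (if i \<le> m then complex_of_real (r (?T i)) else 0)" for i
      by (simp add: p_def coeff_sum if_distrib cong: if_cong)
    have "coeff p k \<noteq> 0" using r(3) k by (simp add: coef)
    then have "p \<noteq> 0" by auto
    have "degree p \<le> m" by (rule degree_le) (simp add: coef)
    from poly_orbit_bound[OF this] have "poly_orbit p A x = (\<Sum>i\<le>m. r (?T i) *\<^sub>R ?T i)"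
      by (simp add: coef smult_of_real)
    also have "\<dots> = 0" using r(1) by (simp add: sum.reindex[OF True])
    finally show ?thesis using \<open>p \<noteq> 0\<close> by blast
  qed
qed

text \<open>
  Over the complex numbers an annihilating polynomial has a root \<open>c\<close>. Either \<open>x\<close> is an eigenvector
  for \<open>c\<close>, or \<open>A x - c x\<close> is a nonzero vector of the subspace annihilated by a polynomial of
  smaller degree.
\<close>

lemma eigenvector_in_invariant_subspace:
  fixes A :: "complex^'n^'n"
  assumes diff: "\<And>x y. x \<in> W \<Longrightarrow> y \<in> W \<Longrightarrow> x - y \<in> W"
    and scale: "\<And>c x. x \<in> W \<Longrightarrow> c *s x \<in> W"
    and inv: "\<And>x. x \<in> W \<Longrightarrow> A *v x \<in> W"
    and x: "x \<in> W" "x \<noteq> 0"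
  shows "\<exists>v\<in>W. v \<noteq> 0 \<and> (\<exists>c. A *v v = c *s v)"
proof -
  have "\<exists>v\<in>W. v \<noteq> 0 \<and> (\<exists>c. A *v v = c *s v)"
    if "p \<noteq> 0" "poly_orbit p A x = 0" "x \<in> W" "x \<noteq> 0" for p x
    using that
  proof (induction "degree p" arbitrary: p x)
    case 0
    then show ?case by (auto simp: poly_orbit_def elim!: degree_eq_zeroE)
  next
    case (Suc n)
    then obtain c where "poly p c = 0"
      using fundamental_theorem_of_algebra[of p] by (auto simp: constant_degree)
    then obtain q where q: "p = [:- c, 1:] * q" by (auto simp: poly_eq_0_iff_dvd)
    have q0: "q \<noteq> 0" using Suc.prems q by auto
    have deg: "n = degree q" using Suc.hyps(2) q0 unfolding q by (subst (asm) degree_mult_eq) auto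
    show ?case
    proof (cases "A *v x - c *s x = 0")
      case True
      then show ?thesis using Suc.prems by auto
    next
      case False
      show ?thesis
        using Suc.hyps(1)[OF deg q0 _ _ False] Suc.prems q
        by (auto simp: poly_orbit_linear_factor diff scale inv simp del: mult_pCons_left)
    qed
  qed
  then show ?thesis using annihilating_poly_exists[of A x] x by blast
qed

section \<open>Eigenvectors of normal matrices\<close>

text \<open>
  Expanding \<open>\<parallel>A\<^sup>* x - cnj c x\<parallel>\<^sup>2\<close> and using that \<open>A\<close> commutes with its adjoint
  gives zero.
\<close>

lemma normal_adjoint_eigenvector:
  assumes "normal_matrix A" "A *v x = c *s x"
  shows "conj_transpose A *v x = cnj c *s x"
proof -
  let ?B = "conj_transpose A"
  have AB: "A *v (?B *v x) = ?B *v (A *v x)"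
    using assms(1) by (simp add: normal_matrix_def matrix_vector_mul_assoc)
  have left: "cdot (?B *v x) y = cdot x (A *v y)" for y by (simp add: cdot_adjoint)
  have right: "cdot y (?B *v x) = cdot (A *v y) x" for y
    by (simp add: cdot_adjoint conj_transpose_involution)
  have "cdot (?B *v x - cnj c *s x) (?B *v x - cnj c *s x) = 0"
    by (simp add: cdot_diff_right cdot_diff_left cdot_scale_right cdot_scale_left left right
        AB assms(2) vector_scalar_commute matrix_vector_mult_diff_distrib)
  then show ?thesis by (simp add: cdot_self)
qed


lemma normal_eigenvectors_orthogonal:
  assumes "normal_matrix A" "A *v x = c *s x" "A *v y = e *s y" "c \<noteq> e"
  shows "cdot x y = 0"
proof -
  have "e * cdot x y = cdot x (A *v y)" by (simp add: assms(3) cdot_scale_right)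
  also have "\<dots> = c * cdot x y"
    by (simp add: cdot_adjoint normal_adjoint_eigenvector[OF assms(1,2)] cdot_scale_left)
  finally show ?thesis using assms(4) by simp
qed

text \<open>
  The vectors orthogonal to all eigenvectors form an invariant subspace, because eigenvectors of
  \<open>A\<close> are eigenvectors of the adjoint. If the subspace were nonzero, it would contain
  an eigenvector, which would be orthogonal to itself.
\<close>

lemma normal_eigenvectors_total:
  assumes "normal_matrix A" and orth: "\<And>y c. A *v y = c *s y \<Longrightarrow> cdot y x = 0"
  shows "x = 0"
proof (rule ccontr)
  assume "x \<noteq> 0"
  define W where "W = {x. \<forall>y c. A *v y = c *s y \<longrightarrow> cdot y x = 0}"
  have "\<exists>v\<in>W. v \<noteq> 0 \<and> (\<exists>c. A *v v = c *s v)"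
  proof (rule eigenvector_in_invariant_subspace)
    show "A *v w \<in> W" if "w \<in> W" for w
      unfolding W_def
    proof (clarify)
      fix y c assume y: "A *v y = c *s y"
      with that have "cdot y w = 0" by (auto simp: W_def)
      then show "cdot y (A *v w) = 0"
        by (simp add: cdot_adjoint normal_adjoint_eigenvector[OF assms(1) y] cdot_scale_left)
    qed
  qed (use orth \<open>x \<noteq> 0\<close> in \<open>auto simp: W_def cdot_diff_right cdot_scale_right\<close>)
  then obtain v where "v \<in> W" "v \<noteq> 0" "\<exists>c. A *v v = c *s v" by blast
  then have "cdot v v = 0" by (auto simp: W_def)
  with \<open>v \<noteq> 0\<close> show False by (simp add: cdot_self)
qed

section \<open>The residual off the unit sphere\<close>

lemma rayleigh_scale: "rayleigh A (c *s u) = complex_of_real ((cmod c)\<^sup>2) * rayleigh A u"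
  by (simp add: rayleigh_def vector_scalar_commute cdot_scale_left cdot_scale_right
      complex_norm_square mult_ac del: of_real_power)

text \<open>
  \<open>A u - z u\<close> is the component of \<open>A u\<close> orthogonal to \<open>u\<close>, so Pythagoras applies.
\<close>

lemma residual_unit:
  assumes "norm u = 1"
  shows "residual A u = (norm (A *v u))\<^sup>2 - (cmod (rayleigh A u))\<^sup>2"
proof -
  let ?z = "rayleigh A u"
  have z: "cdot (A *v u) u = cnj ?z" by (simp add: rayleigh_def cnj_cdot)
  have "complex_of_real (residual A u) = cdot (A *v u - ?z *s u) (A *v u - ?z *s u)"
    by (simp add: residual_def cdot_self)
  also have "\<dots> = cdot (A *v u) (A *v u) - cnj ?z * ?z"
    using assms by (simp add: cdot_diff_right cdot_diff_left cdot_scale_right cdot_scale_left z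
        cdot_self[of u] rayleigh_def[symmetric])
  also have "\<dots> = complex_of_real ((norm (A *v u))\<^sup>2 - (cmod ?z)\<^sup>2)"
    by (simp add: cdot_self complex_norm_square mult.commute del: of_real_power)
  finally show ?thesis using of_real_eq_iff by blast
qed

text \<open>
  The composition with \<open>sgn\<close> is the extension of the residual that is constant on complex lines. In
  this rational form it can be differentiated without differentiating \<open>sgn\<close>. At \<open>w = 0\<close> both
  sides are zero.
\<close>

lemma residual_sgn:
  "residual A (sgn w) = (norm (A *v w))\<^sup>2 / (norm w)\<^sup>2 - (cmod (rayleigh A w))\<^sup>2 / ((norm w)\<^sup>2)\<^sup>2"
proof (cases "w = 0")
  case True
  then show ?thesis by (simp add: residual_def)
next
  case False
  let ?c = "complex_of_real (inverse (norm w))"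
  have sgn: "sgn w = ?c *s w"
    by (simp only: sgn_div_norm smult_of_real)
  have "residual A (sgn w) = (norm (A *v sgn w))\<^sup>2 - (cmod (rayleigh A (sgn w)))\<^sup>2"
    using False by (intro residual_unit) (simp add: norm_sgn)
  also have "\<dots> = (cmod ?c * norm (A *v w))\<^sup>2 - ((cmod ?c)\<^sup>2 * cmod (rayleigh A w))\<^sup>2"
    unfolding sgn rayleigh_scale vector_scalar_commute norm_vector_scalar_mult
    by (simp add: norm_mult norm_power)
  also have "\<dots> = (norm (A *v w))\<^sup>2 / (norm w)\<^sup>2 - (cmod (rayleigh A w))\<^sup>2 / ((norm w)\<^sup>2)\<^sup>2"
    by (simp add: norm_inverse power_mult_distrib power_inverse divide_inverse mult.commute
        del: of_real_inverse)
  finally show ?thesis .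
qed

lemma residual_sgn_scale:
  assumes "c \<noteq> 0"
  shows "residual A (sgn (c *s w)) = residual A (sgn w)"
  unfolding residual_sgn rayleigh_scale vector_scalar_commute norm_vector_scalar_mult
  using assms by (simp add: norm_mult power_mult_distrib norm_power field_simps)

lemma cproj_residual_chart_inv:
  assumes "w $ k = 1"
  shows "cproj_residual A (cproj_chart_inv k w) = residual A (sgn w)"
proof -
  have "w \<noteq> 0" using assms by auto
  then have "phase_equiv (sgn w) (sgn w)" by (intro phase_equiv_refl) (simp add: norm_sgn)
  then show ?thesis by (simp add: cproj_chart_inv_def cproj_residual.abs_eq)
qed

section \<open>Criticality on projective space\<close>

text \<open>
  In the chart with index \<open>k\<close> the point is \<open>u / u\<^sub>k\<close>, and by invariance under
  complex scalars the derivative there is the derivative at \<open>u\<close> composed with multiplication by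
  \<open>u\<^sub>k\<close>. The chart only tests directions with vanishing \<open>k\<close>-th coordinate. The orthogonality
  assumption supplies the rest: after subtracting a complex multiple of \<open>u\<close> from the gradient
  \<open>G\<close> one gets a direction that the chart does test, and on which the differential still
  takes the value \<open>2 * (G \<bullet> G)\<close>.
\<close>

lemma critical_iff_gradient_eq_0:
  fixes A :: "complex^'n^'n"
  assumes u: "norm u = 1"
    and deriv: "((\<lambda>w. residual A (sgn w)) has_derivative (\<lambda>h. 2 * (G \<bullet> h))) (at u)"
    and orth: "cdot G u = 0"
  shows "cproj_critical (cproj_residual A) (abs_cproj u) \<longleftrightarrow> G = 0"
proof -
  let ?g = "\<lambda>w. residual A (sgn w)"
  have pe: "phase_equiv u u" using u by (rule phase_equiv_refl)
  have chart_deriv: "(?g has_derivative (\<lambda>h. 2 * (G \<bullet> (u $ k *s h)))) (at ((1 / u $ k) *s u))"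
    if k: "u $ k \<noteq> 0" for k
  proof -
    let ?x = "(1 / u $ k) *s u"
    let ?M = "mat (u $ k) :: complex^'n^'n"
    have "(*v) ?M = (*s) (u $ k)" by (simp add: fun_eq_iff mat_mult_vec)
    then have scale: "((\<lambda>w. u $ k *s w) has_derivative (\<lambda>h. u $ k *s h)) (at ?x)"
      using bounded_linear_imp_has_derivative[OF matrix_vector_mul_bounded_linear[of ?M]]
      by simp
    have "u $ k *s ?x = u" using k by (simp add: vector_smult_assoc)
    then have "(?g has_derivative (\<lambda>h. 2 * (G \<bullet> h))) (at (u $ k *s ?x))" using deriv by simp
    from has_derivative_compose[OF scale this] show ?thesis
      by (simp add: residual_sgn_scale k)
  qed
  have critical: "cproj_critical (cproj_residual A) (abs_cproj u) \<longleftrightarrow>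
      (\<forall>k. u $ k \<noteq> 0 \<longrightarrow> (?g has_derivative (\<lambda>h. 0)) (at ((1 / u $ k) *s u) within {w. w $ k = 1}))"
  proof -
    have "((\<lambda>w. cproj_residual A (cproj_chart_inv k w)) has_derivative (\<lambda>h. 0)) (at x within {w. w $ k = 1})
        \<longleftrightarrow> (?g has_derivative (\<lambda>h. 0)) (at x within {w. w $ k = 1})"
      if "x $ k = 1" for x k
    proof -
      have x: "x \<in> {w. w $ k = 1}" using that by simp
      have eq: "cproj_residual A (cproj_chart_inv k w) = ?g w" if "w \<in> {w. w $ k = 1}" for w
        using that by (simp add: cproj_residual_chart_inv)
      show ?thesis
        by (rule iffI) (erule has_derivative_transform[OF x, rotated], simp add: eq)+
    qed
    then show ?thesis
      unfolding cproj_critical_def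
        cproj_chart_dom.abs_eq[OF pe] cproj_chart.abs_eq[OF pe]
      by (intro all_cong imp_cong refl) simp
  qed
  show ?thesis
  proof
    assume "G = 0"
    then show "cproj_critical (cproj_residual A) (abs_cproj u)"
      unfolding critical using chart_deriv by (auto intro: has_derivative_at_withinI)
  next
    assume crit: "cproj_critical (cproj_residual A) (abs_cproj u)"
    have "u \<noteq> 0" using u by auto
    then obtain k where k: "u $ k \<noteq> 0" by (auto simp: vec_eq_iff)
    let ?x = "(1 / u $ k) *s u"
    \<comment> \<open>The direction in the chart that corresponds to \<open>G\<close>, made tangent to the hyperplane by
      removing a multiple of \<open>u\<close>.\<close>
    define v where "v = (1 / u $ k) *s (G - (G $ k / u $ k) *s u)"
    have vk: "v $ k = 0" using k by (simp add: v_def)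
    \<comment> \<open>Derivatives within the hyperplane are not unique as linear maps on the whole space, so the
      two are compared along a line inside it.\<close>
    let ?\<gamma> = "\<lambda>t::real. ?x + t *\<^sub>R v"
    have line: "(?\<gamma> has_derivative (\<lambda>t. t *\<^sub>R v)) (at 0)"
      by (auto intro!: derivative_eq_intros)
    have "(?g has_derivative (\<lambda>h. 0)) (at (?\<gamma> 0) within range ?\<gamma>)"
      using crit k vk unfolding critical by (auto intro: has_derivative_subset)
    from has_derivative_in_compose[OF line this]
    have 1: "((\<lambda>t. ?g (?\<gamma> t)) has_derivative (\<lambda>t. 0)) (at 0)" .
    have "(?g has_derivative (\<lambda>h. 2 * (G \<bullet> (u $ k *s h)))) (at (?\<gamma> 0))"
      using chart_deriv[OF k] by simp
    from has_derivative_compose[OF line this]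
    have 2: "((\<lambda>t. ?g (?\<gamma> t)) has_derivative (\<lambda>t. 2 * (G \<bullet> (u $ k *s (t *\<^sub>R v))))) (at 0)" .
    have "0 = 2 * (G \<bullet> (u $ k *s (1 *\<^sub>R v)))"
      using fun_cong[OF has_derivative_unique[OF 1 2], of 1] .
    then have "G \<bullet> (u $ k *s v) = 0" by simp
    moreover have "u $ k *s v = G - (G $ k / u $ k) *s u"
      using k by (simp add: v_def vector_smult_assoc)
    ultimately have "G \<bullet> G = 0"
      by (simp add: inner_diff_right inner_eq_Re_cdot[of G "_ *s u"] cdot_scale_right orth)
    then show "G = 0" by simp
  qed
qed


section \<open>The spectral resolution of a normal matrix\<close>

locale normal_resolution =
  fixes A :: "complex^'n^'n" and d :: nat and \<mu> :: "nat \<Rightarrow> complex"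
    and P :: "nat \<Rightarrow> complex^'n^'n"
  assumes normal: "normal_matrix A"
    and eigenvals: "bij_betw \<mu> {1..d} (eigenvalues A)"
    and proj: "\<And>\<alpha>. \<alpha> \<in> {1..d} \<Longrightarrow> orth_projection_onto (P \<alpha>) (eigenspace A (\<mu> \<alpha>))"
begin

(* Otherwise the simplifier turns the index range {1..d} into {Suc 0..d}, and the sum rules below
   no longer match. *)
declare One_nat_def [simp del]

lemma eigenvector_projection:
  assumes "\<alpha> \<in> {1..d}"
  shows "A *v (P \<alpha> *v x) = \<mu> \<alpha> *s (P \<alpha> *v x)"
  using proj[OF assms] unfolding orth_projection_onto_def mem_eigenspace by blast

lemma cdot_eigenvector_projection:
  assumes "\<alpha> \<in> {1..d}" "A *v y = \<mu> \<alpha> *s y"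
  shows "cdot y (P \<alpha> *v x) = cdot y x"
proof -
  have "y \<in> eigenspace A (\<mu> \<alpha>)" using assms(2) by (simp add: mem_eigenspace)
  then have "cdot y (x - P \<alpha> *v x) = 0"
    using proj[OF assms(1)] unfolding orth_projection_onto_def by blast
  then show ?thesis by (simp add: cdot_diff_right)
qed

lemma eigenvector_orthogonal_projection:
  assumes "\<alpha> \<in> {1..d}" "\<beta> \<in> {1..d}" "\<alpha> \<noteq> \<beta>" "A *v y = \<mu> \<alpha> *s y"
  shows "cdot y (P \<beta> *v x) = 0"
proof -
  have "\<mu> \<alpha> \<noteq> \<mu> \<beta>"
    using inj_on_eq_iff[OF bij_betw_imp_inj_on[OF eigenvals] assms(1,2)] assms(3) by simp
  then show ?thesis
    by (rule normal_eigenvectors_orthogonal[OF normal assms(4) eigenvector_projection[OF assms(2)]])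
qed

lemma cdot_projections:
  assumes "\<alpha> \<in> {1..d}" "\<beta> \<in> {1..d}"
  shows "cdot (P \<alpha> *v x) (P \<beta> *v x) = (if \<alpha> = \<beta> then complex_of_real (weight P x \<alpha>) else 0)"
  using eigenvector_orthogonal_projection[OF assms _ eigenvector_projection[OF assms(1)]]
  by (simp add: cdot_self weight_def)

text \<open>
  The difference of both sides is orthogonal to every eigenvector \<open>y\<close>: only the projection onto the
  eigenspace of \<open>y\<close> contributes to the product of \<open>y\<close> with the sum.
\<close>

lemma sum_projections: "(\<Sum>\<alpha>=1..d. P \<alpha> *v x) = x"
proof -
  have "x - (\<Sum>\<alpha>=1..d. P \<alpha> *v x) = 0"
  proof (rule normal_eigenvectors_total[OF normal])
    fix y c assume y: "A *v y = c *s y"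
    show "cdot y (x - (\<Sum>\<alpha>=1..d. P \<alpha> *v x)) = 0"
    proof (cases "y = 0")
      case True
      then show ?thesis by (simp add: cdot_def)
    next
      case False
      with y have "c \<in> \<mu> ` {1..d}"
        unfolding bij_betw_imp_surj_on[OF eigenvals] by (auto simp: eigenvalues_def)
      then obtain \<beta> where \<beta>: "\<beta> \<in> {1..d}" "c = \<mu> \<beta>" by blast
      have y\<beta>: "A *v y = \<mu> \<beta> *s y" using y \<beta>(2) by simp
      have "cdot y (P \<alpha> *v x) = (if \<alpha> = \<beta> then cdot y x else 0)" if "\<alpha> \<in> {1..d}" for \<alpha>
        using cdot_eigenvector_projection[OF \<beta>(1) y\<beta>]
          eigenvector_orthogonal_projection[OF \<beta>(1) that _ y\<beta>] by auto
      then have "(\<Sum>\<alpha>=1..d. cdot y (P \<alpha> *v x)) = (\<Sum>\<alpha>=1..d. if \<alpha> = \<beta> then cdot y x else 0)"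
        by (rule sum.cong[OF refl])
      then show ?thesis using \<beta> by (simp add: cdot_diff_right cdot_sum_right)
    qed
  qed
  then show ?thesis by simp
qed

lemma apply_resolution: "A *v x = (\<Sum>\<alpha>=1..d. \<mu> \<alpha> *s (P \<alpha> *v x))"
proof -
  have "A *v x = A *v (\<Sum>\<alpha>=1..d. P \<alpha> *v x)" by (simp only: sum_projections)
  also have "\<dots> = (\<Sum>\<alpha>=1..d. A *v (P \<alpha> *v x))"
    by (rule linear_sum) (rule matrix_vector_mul_linear)
  also have "\<dots> = (\<Sum>\<alpha>=1..d. \<mu> \<alpha> *s (P \<alpha> *v x))"
    by (simp add: eigenvector_projection)
  finally show ?thesis .
qed

lemma spectral_resolution: "A = (\<Sum>\<alpha>=1..d. mat (\<mu> \<alpha>) ** P \<alpha>)"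
proof -
  have "sum f S *v x = (\<Sum>\<alpha>\<in>S. f \<alpha> *v x)" if "finite S"
    for f :: "nat \<Rightarrow> complex^'n^'n" and S x
    using that by (induction S) (simp_all add: matrix_vector_mult_add_rdistrib)
  then show ?thesis
    by (simp add: matrix_eq apply_resolution mat_mult_vec matrix_vector_mul_assoc[symmetric])
qed

lemma cdot_resolution:
  "cdot (\<Sum>\<alpha>=1..d. a \<alpha> *s (P \<alpha> *v x)) (\<Sum>\<alpha>=1..d. b \<alpha> *s (P \<alpha> *v x)) =
    (\<Sum>\<alpha>=1..d. complex_of_real (weight P x \<alpha>) * (cnj (a \<alpha>) * b \<alpha>))"
proof -
  have "cdot (\<Sum>\<alpha>=1..d. a \<alpha> *s (P \<alpha> *v x)) (\<Sum>\<alpha>=1..d. b \<alpha> *s (P \<alpha> *v x)) =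
    (\<Sum>\<alpha>=1..d. \<Sum>\<beta>=1..d. cnj (a \<alpha>) * (b \<beta> * cdot (P \<alpha> *v x) (P \<beta> *v x)))"
    by (simp only: cdot_sum_left)
       (simp add: cdot_sum_right cdot_scale_left cdot_scale_right sum_distrib_left mult.left_commute)
  also have "\<dots> = (\<Sum>\<alpha>=1..d. \<Sum>\<beta>=1..d.
      if \<alpha> = \<beta> then cnj (a \<alpha>) * (b \<beta> * complex_of_real (weight P x \<alpha>)) else 0)"
    by (intro sum.cong refl) (simp add: cdot_projections)
  finally show ?thesis by (simp add: mult_ac)
qed

lemma norm_resolution:
  "(norm (\<Sum>\<alpha>=1..d. a \<alpha> *s (P \<alpha> *v x)))\<^sup>2 = (\<Sum>\<alpha>=1..d. weight P x \<alpha> * (cmod (a \<alpha>))\<^sup>2)"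
proof -
  have "complex_of_real ((norm (\<Sum>\<alpha>=1..d. a \<alpha> *s (P \<alpha> *v x)))\<^sup>2) =
      complex_of_real (\<Sum>\<alpha>=1..d. weight P x \<alpha> * (cmod (a \<alpha>))\<^sup>2)"
    unfolding cdot_self[symmetric] cdot_resolution
    by (simp add: complex_norm_square mult.commute del: of_real_power)
  then show ?thesis using of_real_eq_iff by blast
qed

lemma norm_eq_sum_weights: "(norm x)\<^sup>2 = (\<Sum>\<alpha>=1..d. weight P x \<alpha>)"
  using norm_resolution[of "\<lambda>_. 1" x] by (simp add: sum_projections)

lemma norm_apply_eq_sum_weights: "(norm (A *v x))\<^sup>2 = (\<Sum>\<alpha>=1..d. weight P x \<alpha> * (cmod (\<mu> \<alpha>))\<^sup>2)"
  by (simp add: apply_resolution norm_resolution)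

lemma rayleigh_eq_sum_weights: "rayleigh A x = (\<Sum>\<alpha>=1..d. complex_of_real (weight P x \<alpha>) * \<mu> \<alpha>)"
  using cdot_resolution[of "\<lambda>_. 1" x \<mu>]
  by (simp add: rayleigh_def sum_projections apply_resolution)

lemma residual_eq_sum_weights:
  "residual A x = (\<Sum>\<alpha>=1..d. weight P x \<alpha> * (cmod (\<mu> \<alpha> - rayleigh A x))\<^sup>2)"
proof -
  let ?z = "rayleigh A x"
  have "A *v x - ?z *s x = (\<Sum>\<alpha>=1..d. \<mu> \<alpha> *s (P \<alpha> *v x)) - ?z *s (\<Sum>\<alpha>=1..d. P \<alpha> *v x)"
    by (simp only: apply_resolution[symmetric] sum_projections)
  also have "\<dots> = (\<Sum>\<alpha>=1..d. (\<mu> \<alpha> - ?z) *s (P \<alpha> *v x))"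
    by (simp add: vec.scale_sum_right vec.scale_left_diff_distrib sum_subtractf)
  finally show ?thesis by (simp only: residual_def norm_resolution)
qed

section \<open>The gradient of the residual\<close>

text \<open>
  At unit vectors this is half of the gradient of \<open>w \<mapsto> residual A (sgn w)\<close> with respect to the
  real inner product, as \<open>has_derivative_residual\<close> shows.
\<close>

definition gradient :: "complex^'n \<Rightarrow> complex^'n" where
  "gradient u = (\<Sum>\<alpha>=1..d.
     complex_of_real ((cmod (\<mu> \<alpha> - rayleigh A u))\<^sup>2 - residual A u) *s (P \<alpha> *v u))"

text \<open>
  The residual is the mean of the squared distances \<open>|\<mu>\<^sub>\<alpha> - z|\<^sup>2\<close> with respect to the weights, so
  the coefficients of the gradient have mean zero.
\<close>

lemma cdot_gradient_self:
  assumes "norm u = 1"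
  shows "cdot (gradient u) u = 0"
proof -
  define c where "c \<alpha> = (cmod (\<mu> \<alpha> - rayleigh A u))\<^sup>2 - residual A u" for \<alpha>
  have "(\<Sum>\<alpha>=1..d. weight P u \<alpha>) = 1" using assms by (simp add: norm_eq_sum_weights[symmetric])
  then have zero: "(\<Sum>\<alpha>=1..d. weight P u \<alpha> * c \<alpha>) = 0"
    using residual_eq_sum_weights[of u]
    by (simp add: c_def right_diff_distrib sum_subtractf flip: sum_distrib_right)
  have "cdot (gradient u) u = complex_of_real (\<Sum>\<alpha>=1..d. weight P u \<alpha> * c \<alpha>)"
    using cdot_resolution[of "\<lambda>\<alpha>. complex_of_real (c \<alpha>)" u "\<lambda>_. 1"]
    by (simp add: gradient_def c_def[symmetric] sum_projections)
  then show ?thesis by (simp only: zero of_real_0)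
qed

lemma gradient_eq_0_iff:
  "gradient u = 0 \<longleftrightarrow> (\<forall>\<alpha>\<in>active_set d P u. (cmod (\<mu> \<alpha> - rayleigh A u))\<^sup>2 = residual A u)"
proof -
  let ?c = "\<lambda>\<alpha>. (cmod (\<mu> \<alpha> - rayleigh A u))\<^sup>2 - residual A u"
  have "gradient u = 0 \<longleftrightarrow> (norm (gradient u))\<^sup>2 = 0" by simp
  also have "\<dots> \<longleftrightarrow> (\<Sum>\<alpha>=1..d. weight P u \<alpha> * (?c \<alpha>)\<^sup>2) = 0"
    unfolding gradient_def norm_resolution norm_of_real by simp
  also have "\<dots> \<longleftrightarrow> (\<forall>\<alpha>\<in>{1..d}. weight P u \<alpha> * (?c \<alpha>)\<^sup>2 = 0)"
    by (rule sum_nonneg_eq_0_iff) (simp_all add: weight_def)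
  also have "\<dots> \<longleftrightarrow> (\<forall>\<alpha>\<in>active_set d P u. (cmod (\<mu> \<alpha> - rayleigh A u))\<^sup>2 = residual A u)"
    by (auto simp: active_set_def weight_def)
  finally show ?thesis .
qed

text \<open>
  The derivative of \<open>\<parallel>P\<^sub>\<alpha> w\<parallel>\<^sup>2\<close> in direction \<open>h\<close> pairs \<open>P\<^sub>\<alpha> u\<close> with \<open>P\<^sub>\<alpha> h\<close>; as the
  projection is orthogonal, \<open>P\<^sub>\<alpha> h\<close> may be replaced by \<open>h\<close>.
\<close>

lemma has_derivative_weight:
  assumes "\<alpha> \<in> {1..d}"
  shows "((\<lambda>w. weight P w \<alpha>) has_derivative (\<lambda>h. 2 * ((P \<alpha> *v u) \<bullet> h))) (at u)"
proof -
  have lin: "((\<lambda>w. P \<alpha> *v w) has_derivative (\<lambda>h. P \<alpha> *v h)) (at u)"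
    by (intro bounded_linear_imp_has_derivative matrix_vector_mul_bounded_linear)
  have "(P \<alpha> *v u) \<bullet> (P \<alpha> *v h) = (P \<alpha> *v u) \<bullet> h" for h
    by (simp add: inner_eq_Re_cdot cdot_eigenvector_projection[OF assms eigenvector_projection[OF assms]])
  then have "(P \<alpha> *v u) \<bullet> (P \<alpha> *v h) + (P \<alpha> *v h) \<bullet> (P \<alpha> *v u) = 2 * ((P \<alpha> *v u) \<bullet> h)" for h
    by (simp add: inner_commute[of "P \<alpha> *v h"])
  with has_derivative_inner[OF lin lin] show ?thesis
    by (simp add: weight_def power2_norm_eq_inner)
qed

lemma has_derivative_weighted_sum:
  "((\<lambda>w. \<Sum>\<alpha>=1..d. weight P w \<alpha> * c \<alpha>) has_derivative
    (\<lambda>h. 2 * (\<Sum>\<alpha>=1..d. c \<alpha> * ((P \<alpha> *v u) \<bullet> h)))) (at u)"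
  by (rule has_derivative_eq_rhs, rule has_derivative_sum,
      rule has_derivative_mult_left, rule has_derivative_weight)
     (simp_all add: sum_distrib_left mult_ac)

text \<open>
  All ingredients of the formula for \<open>residual A (sgn w)\<close> are real weighted sums
  \<open>Q c w\<close>, with coefficients \<open>|\<mu>\<^sub>\<alpha>|\<^sup>2\<close>, \<open>Re \<mu>\<^sub>\<alpha>\<close>, \<open>Im \<mu>\<^sub>\<alpha>\<close> and \<open>1\<close>. So the quotient
  rule reduces the claim to an identity between their derivatives.
\<close>

lemma has_derivative_residual:
  assumes u: "norm u = 1"
  shows "((\<lambda>w. residual A (sgn w)) has_derivative (\<lambda>h. 2 * (gradient u \<bullet> h))) (at u)"
proof -
  define Q where "Q c w = (\<Sum>\<alpha>=1..d. weight P w \<alpha> * c \<alpha>)" for c :: "nat \<Rightarrow> real" and w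
  define L where "L c h = (\<Sum>\<alpha>=1..d. c \<alpha> * ((P \<alpha> *v u) \<bullet> h))" for c :: "nat \<Rightarrow> real" and h
  let ?s = "\<lambda>\<alpha>. (cmod (\<mu> \<alpha>))\<^sup>2"
  let ?a = "\<lambda>\<alpha>. Re (\<mu> \<alpha>)" and ?b = "\<lambda>\<alpha>. Im (\<mu> \<alpha>)" and ?one = "\<lambda>\<alpha>::nat. 1::real"
  have Q': "(Q c has_derivative (\<lambda>h. 2 * L c h)) (at u)" for c
    unfolding Q_def L_def by (rule has_derivative_weighted_sum)
  have N: "Q ?one w = (norm w)\<^sup>2" for w by (simp add: Q_def norm_eq_sum_weights)
  have N1: "Q ?one u = 1" by (simp add: N u)
  have z: "Re (rayleigh A w) = Q ?a w" "Im (rayleigh A w) = Q ?b w" for w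
    by (simp_all add: rayleigh_eq_sum_weights Q_def)
  have res: "residual A (sgn w) = Q ?s w / Q ?one w - ((Q ?a w)\<^sup>2 + (Q ?b w)\<^sup>2) / (Q ?one w)\<^sup>2" for w
    by (simp add: residual_sgn cmod_power2[of "rayleigh A w"] z N)
       (simp add: norm_apply_eq_sum_weights Q_def)
  have ru: "residual A u = Q ?s u - ((Q ?a u)\<^sup>2 + (Q ?b u)\<^sup>2)"
    using res[of u] u by (simp add: N1 sgn_div_norm)
  have coeff: "(cmod (\<mu> \<alpha> - rayleigh A u))\<^sup>2 - residual A u =
      ?s \<alpha> - Q ?s u - 2 * Q ?a u * ?a \<alpha> - 2 * Q ?b u * ?b \<alpha> + 2 * ((Q ?a u)\<^sup>2 + (Q ?b u)\<^sup>2)" for \<alpha>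
    unfolding ru cmod_power2 by (simp add: z power2_eq_square algebra_simps)
  have inner: "gradient u \<bullet> h = (\<Sum>\<alpha>=1..d. ((cmod (\<mu> \<alpha> - rayleigh A u))\<^sup>2 - residual A u) * ((P \<alpha> *v u) \<bullet> h))" for h
    by (simp only: gradient_def smult_of_real inner_sum_left inner_scaleR_left)
  have G: "gradient u \<bullet> h = L ?s h - Q ?s u * L ?one h - 2 * Q ?a u * L ?a h - 2 * Q ?b u * L ?b h
      + 2 * ((Q ?a u)\<^sup>2 + (Q ?b u)\<^sup>2) * L ?one h" for h
    unfolding inner coeff L_def
    by (simp add: sum_distrib_left sum_subtractf sum.distrib distrib_right left_diff_distrib mult.assoc)
  have "((\<lambda>w. Q ?s w / Q ?one w - ((Q ?a w)\<^sup>2 + (Q ?b w)\<^sup>2) / (Q ?one w)\<^sup>2) has_derivative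
      (\<lambda>h. 2 * (gradient u \<bullet> h))) (at u)"
    by (rule derivative_eq_intros Q' | simp add: N1)+
       (simp add: N1 G fun_eq_iff power2_eq_square algebra_simps)
  then show ?thesis by (simp only: res)
qed

section \<open>Critical points and critical sets\<close>

lemma critical_iff:
  assumes "norm u = 1"
  shows "cproj_critical (cproj_residual A) (abs_cproj u) \<longleftrightarrow>
    (\<forall>\<alpha>\<in>active_set d P u. (cmod (\<mu> \<alpha> - rayleigh A u))\<^sup>2 = residual A u)"
  using critical_iff_gradient_eq_0[OF assms has_derivative_residual cdot_gradient_self] assms
  by (simp add: gradient_eq_0_iff)

lemma cocircular_iff:
  "\<mu> ` active_set d P u \<subseteq> sphere (rayleigh A u) (sqrt (residual A u)) \<longleftrightarrow>
    (\<forall>\<alpha>\<in>active_set d P u. (cmod (\<mu> \<alpha> - rayleigh A u))\<^sup>2 = residual A u)"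
proof -
  have "residual A u \<ge> 0" by (simp add: residual_def)
  then have "cmod w = sqrt (residual A u) \<longleftrightarrow> (cmod w)\<^sup>2 = residual A u" for w
    by (metis norm_ge_zero real_sqrt_pow2 real_sqrt_abs abs_of_nonneg)
  then show ?thesis by (auto simp: dist_norm norm_minus_commute)
qed

text \<open>
  The Rayleigh quotient, the residual and the active set depend on the vector only through its
  weights, and by \<open>critical_iff\<close> so does criticality.
\<close>

lemma critical_cong_weights:
  assumes "norm u = 1" "norm v = 1" and eq: "\<And>\<alpha>. \<alpha> \<in> {1..d} \<Longrightarrow> weight P u \<alpha> = weight P v \<alpha>"
    and "cproj_critical (cproj_residual A) (abs_cproj v)"
  shows "cproj_critical (cproj_residual A) (abs_cproj u)" "active_set d P u = active_set d P v"
proof -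
  show act: "active_set d P u = active_set d P v"
    using eq by (auto simp: active_set_def)
  have z: "rayleigh A u = rayleigh A v" by (simp add: rayleigh_eq_sum_weights eq)
  have "residual A u = residual A v" by (simp add: residual_eq_sum_weights z eq)
  then show "cproj_critical (cproj_residual A) (abs_cproj u)"
    using assms(4) by (simp add: critical_iff assms(1,2) act z)
qed

text \<open>
  The witness \<open>u0\<close> forces \<open>p\<close> to vanish outside \<open>S\<close>. So the conditions on the right-hand side fix
  all weights, and criticality carries over from \<open>u0\<close>.
\<close>

lemma critical_set_eq:
  assumes u0: "norm u0 = 1" "cproj_critical (cproj_residual A) (abs_cproj u0)"
    "active_set d P u0 = S" "\<And>\<alpha>. \<alpha> \<in> {1..d} \<Longrightarrow> weight P u0 \<alpha> = p \<alpha>"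
  shows "{u. norm u = 1 \<and> cproj_critical (cproj_residual A) (abs_cproj u) \<and>
          active_set d P u = S \<and> (\<forall>\<alpha>\<in>{1..d}. weight P u \<alpha> = p \<alpha>)}
      = {u \<in> sphere 0 1. (\<forall>\<alpha>\<in>S. (norm (P \<alpha> *v u))\<^sup>2 = p \<alpha>) \<and>
                         (\<forall>\<beta>\<in>{1..d} - S. P \<beta> *v u = 0)}" (is "?C = ?D")
proof (intro set_eqI iffI)
  fix u assume "u \<in> ?C"
  then show "u \<in> ?D" by (auto simp: active_set_def weight_def)
next
  fix u assume u: "u \<in> ?D"
  have S: "S \<subseteq> {1..d}" using u0(3) by (auto simp: active_set_def)
  have inactive: "p \<beta> = 0" if "\<beta> \<in> {1..d} - S" for \<beta>
    using that u0(3) u0(4)[of \<beta>] by (auto simp: active_set_def weight_def)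
  have w: "weight P u \<alpha> = p \<alpha>" if "\<alpha> \<in> {1..d}" for \<alpha>
    using that u inactive[of \<alpha>] by (cases "\<alpha> \<in> S") (auto simp: weight_def)
  have "norm u = 1" using u by simp
  from critical_cong_weights[OF this u0(1) _ u0(2)] w u0(3,4) u show "u \<in> ?C" by auto
qed

end

theorem theorem4p5:
  fixes A :: "complex^'n^'n"
    and d :: nat
    and \<mu> :: "nat \<Rightarrow> complex"
    and P :: "nat \<Rightarrow> complex^'n^'n"
  assumes normal: "normal_matrix A"
    and eigenvals: "bij_betw \<mu> {1..d} (eigenvalues A)"
    and proj: "\<forall>\<alpha>\<in>{1..d}. orth_projection_onto (P \<alpha>) (eigenspace A (\<mu> \<alpha>))"
  shows "A = (\<Sum>\<alpha>=1..d. mat (\<mu> \<alpha>) ** P \<alpha>) \<and>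
    (\<forall>u. norm u = 1 \<longrightarrow>
      (\<Sum>\<alpha>=1..d. weight P u \<alpha>) = 1 \<and>
      rayleigh A u = (\<Sum>\<alpha>=1..d. complex_of_real (weight P u \<alpha>) * \<mu> \<alpha>) \<and>
      residual A u = (\<Sum>\<alpha>=1..d. weight P u \<alpha> * (cmod (\<mu> \<alpha> - rayleigh A u))\<^sup>2) \<and>
      (cproj_critical (cproj_residual A) (abs_cproj u) \<longleftrightarrow>
        (\<forall>\<alpha>\<in>active_set d P u. (cmod (\<mu> \<alpha> - rayleigh A u))\<^sup>2 = residual A u)) \<and>
      (cproj_critical (cproj_residual A) (abs_cproj u) \<longleftrightarrow>
        \<mu> ` active_set d P u \<subseteq> sphere (rayleigh A u) (sqrt (residual A u)))) \<and>
    (\<forall>S p.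
      (\<exists>u. norm u = 1 \<and> cproj_critical (cproj_residual A) (abs_cproj u) \<and>
           active_set d P u = S \<and> (\<forall>\<alpha>\<in>{1..d}. weight P u \<alpha> = p \<alpha>)) \<longrightarrow>
      {u. norm u = 1 \<and> cproj_critical (cproj_residual A) (abs_cproj u) \<and>
          active_set d P u = S \<and> (\<forall>\<alpha>\<in>{1..d}. weight P u \<alpha> = p \<alpha>)}
      = {u \<in> sphere 0 1. (\<forall>\<alpha>\<in>S. (norm (P \<alpha> *v u))\<^sup>2 = p \<alpha>) \<and>
                         (\<forall>\<beta>\<in>{1..d} - S. P \<beta> *v u = 0)})"
proof -
  interpret normal_resolution A d \<mu> P
    using assms by unfold_locales auto
  show ?thesis
  proof (intro conjI allI impI)
    show "A = (\<Sum>\<alpha>=1..d. mat (\<mu> \<alpha>) ** P \<alpha>)" by (rule spectral_resolution)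
  next
    fix u :: "complex^'n" assume u: "norm u = 1"
    show "(\<Sum>\<alpha>=1..d. weight P u \<alpha>) = 1"
      using u by (simp add: norm_eq_sum_weights[symmetric])
    show "rayleigh A u = (\<Sum>\<alpha>=1..d. complex_of_real (weight P u \<alpha>) * \<mu> \<alpha>)"
      by (rule rayleigh_eq_sum_weights)
    show "residual A u = (\<Sum>\<alpha>=1..d. weight P u \<alpha> * (cmod (\<mu> \<alpha> - rayleigh A u))\<^sup>2)"
      by (rule residual_eq_sum_weights)
    show "cproj_critical (cproj_residual A) (abs_cproj u) \<longleftrightarrow>
        (\<forall>\<alpha>\<in>active_set d P u. (cmod (\<mu> \<alpha> - rayleigh A u))\<^sup>2 = residual A u)"
      using u by (rule critical_iff)
    then show "cproj_critical (cproj_residual A) (abs_cproj u) \<longleftrightarrow>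
        \<mu> ` active_set d P u \<subseteq> sphere (rayleigh A u) (sqrt (residual A u))"
      unfolding cocircular_iff .
  next
    fix S p
    assume "\<exists>u. norm u = 1 \<and> cproj_critical (cproj_residual A) (abs_cproj u) \<and>
           active_set d P u = S \<and> (\<forall>\<alpha>\<in>{1..d}. weight P u \<alpha> = p \<alpha>)"
    then show "{u. norm u = 1 \<and> cproj_critical (cproj_residual A) (abs_cproj u) \<and>
          active_set d P u = S \<and> (\<forall>\<alpha>\<in>{1..d}. weight P u \<alpha> = p \<alpha>)}
      = {u \<in> sphere 0 1. (\<forall>\<alpha>\<in>S. (norm (P \<alpha> *v u))\<^sup>2 = p \<alpha>) \<and>
                         (\<forall>\<beta>\<in>{1..d} - S. P \<beta> *v u = 0)}"
      using critical_set_eq by blast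
  qed
qed

end
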